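(* Let $(\mathcal G,\rho,\omega)$ be a symplectic Lie--Rinehart--Jacobi algebra over $A$ with extension $(\widehat{\mathcal G}_\omega,\widehat\rho)$ and canonical form $\eta$. The map $\mathcal J:A\to\widehat{\mathcal G}_\omega$, $\mathcal J(f)=X_f+fe$, is $K$-linear, injective, and satisfies $$[\mathcal J(f),\mathcal J(g)]_\omega=\mathcal J(\{f,g\})\qquad(f,g\in A).$$ It is therefore an isomorphism from the Lie algebra $(A,\{\,,\})$ onto $\mathrm{Cont}_{\mathrm{str}}(\widehat{\mathcal G}_\omega,\eta)$.
   Context: $K$ is a commutative field of characteristic zero and $A$ a commutative unital $K$-algebra; $L_a$ is multiplication by $a$. $\mathrm{Diff}^1_K(A)$ is the set of $K$-linear $D:A\to A$ with $[[D,L_a],L_b]=0$ for all $a,b\in A$. A Lie--Rinehart--Jacobi (LRJ) algebra over $A$ is an $A$-module $\mathcal G$ with a $K$-Lie algebra structure and an $A$-linear map (anchor) $\rho:\mathcal G\to\mathrm{Diff}^1_K(A)$ which is a Lie algebra morphism and satisfies $[x,ay]=a[x,y]+(\rho(x)(a)-a\rho(x)(1_A))y$. $C^p_\rho(\mathcal G,A)=\mathrm{Alt}^p_A(\mathcal G,A)$ is the module of alternating $A$-multilinear maps $\mathcal G^p\to A$, with differential $(d_\rho\beta)(x_0,\dots,x_p)=\sum_i(-1)^i\rho(x_i)\beta(x_0,\dots,\widehat{x_i},\dots,x_p)+\sum_{i<j}(-1)^{i+j}\beta([x_i,x_j],x_0,\dots,\widehat{x_i},\dots,\widehat{x_j},\dots,x_p)$;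 in particular $(d_\rho a)(x)=\rho(x)(a)$. $i_x$ is the interior product and $\mathcal L^\rho_x=i_xd_\rho+d_\rho i_x$. The same notation is used for any LRJ algebra. A symplectic form on $(\mathcal G,\rho)$ is $\omega\in C^2_\rho(\mathcal G,A)$ with $d_\rho\omega=0$ and $\omega^\flat:\mathcal G\to\mathcal G^*=\mathrm{Hom}_A(\mathcal G,A)$, $x\mapsto i_x\omega$, an isomorphism of $A$-modules; $(\mathcal G,\rho,\omega)$ is then a symplectic LRJ algebra. The symplectic gradient $X_a\in\mathcal G$ of $a\in A$ is defined by $i_{X_a}\omega=d_\rho a$, and $\{a,b\}=-\omega(X_a,X_b)$, which is a $K$-Lie bracket on $A$ (the Jacobi bracket). The extension: $\widehat{\mathcal G}_\omega=\mathcal G\oplus Ae$ with $e$ generating a free summand of rank one, with bracket $[x+fe,y+ge]_\omega=[x,y]+(\rho(x)(g)-\rho(y)(f)+\omega(x,y))e$, anchor $\widehat\rho(x+fe)=\rho(x)$, projection $\pi(x+fe)=x$ and canonical form $\eta(x+fe)=f$. $(\widehat{\mathcal G}_\omega,\widehat\rho)$ is an LRJ algebra. An element $u\in\widehat{\mathcal G}_\omega$ is a strict symmetry of $\eta$ if $\mathcal L^{\widehat\rho}_u\eta=0$; $\mathrm{Cont}_{\mathrm{str}}(\widehat{\mathcal G}_\omega,\eta)$ is the set of strict symmetries, a Lie subalgebra of $\widehat{\mathcal G}_\omega$. *)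

theory Defs
  imports Complex_Main "HOL-Library.Product_Plus"
begin

locale comm_unital_algebra = vector_space smult
  for smult :: "'k::field \<Rightarrow> 'a::comm_ring_1 \<Rightarrow> 'a" +
  assumes smult_mult_left: "smult c (a * b) = smult c a * b"

definition op_commutator :: "('a::ab_group_add \<Rightarrow> 'a) \<Rightarrow> ('a \<Rightarrow> 'a) \<Rightarrow> 'a \<Rightarrow> 'a" where
  "op_commutator D E = (\<lambda>a. D (E a) - E (D a))"

definition Diff1 :: "('k::field \<Rightarrow> 'a::comm_ring_1 \<Rightarrow> 'a) \<Rightarrow> ('a \<Rightarrow> 'a) set" where
  "Diff1 smult = {D. Vector_Spaces.linear smult smult D \<and>
     (\<forall>a b. op_commutator (op_commutator D ((*) a)) ((*) b) = (\<lambda>_. 0))}"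

text \<open>Restriction of scalars along the structure map \<open>c \<mapsto> c \<cdot> 1\<close> from \<open>K\<close> to \<open>A\<close>: the
  \<open>K\<close>-vector space underlying an \<open>A\<close>-module.\<close>

definition restrict_scalars ::
  "('k \<Rightarrow> 'a::comm_ring_1 \<Rightarrow> 'a) \<Rightarrow> ('a \<Rightarrow> 'g \<Rightarrow> 'g) \<Rightarrow> 'k \<Rightarrow> 'g \<Rightarrow> 'g" where
  "restrict_scalars smult scale c x = scale (smult c 1) x"

locale lie_algebra = vector_space scale
  for scale :: "'k::field \<Rightarrow> 'v::ab_group_add \<Rightarrow> 'v" +
  fixes bracket :: "'v \<Rightarrow> 'v \<Rightarrow> 'v"
  assumes bracket_linear_left: "Vector_Spaces.linear scale scale (\<lambda>x. bracket x y)"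
    and bracket_linear_right: "Vector_Spaces.linear scale scale (\<lambda>y. bracket x y)"
    and bracket_self: "bracket x x = 0"
    and jacobi: "bracket x (bracket y z) + bracket y (bracket z x) + bracket z (bracket x y) = 0"

locale lie_subalgebra = lie_algebra scale bracket
  for scale :: "'k::field \<Rightarrow> 'v::ab_group_add \<Rightarrow> 'v" and bracket :: "'v \<Rightarrow> 'v \<Rightarrow> 'v" +
  fixes S :: "'v set"
  assumes subspace_S: "subspace S"
    and bracket_closed: "\<And>x y. x \<in> S \<Longrightarrow> y \<in> S \<Longrightarrow> bracket x y \<in> S"

locale lie_algebra_iso_onto =
  source: lie_algebra scale1 bracket1 + target: lie_subalgebra scale2 bracket2 S +
  Vector_Spaces.linear scale1 scale2 \<phi>
  for scale1 :: "'k::field \<Rightarrow> 'v::ab_group_add \<Rightarrow> 'v" and bracket1 :: "'v \<Rightarrow> 'v \<Rightarrow> 'v"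
    and scale2 :: "'k \<Rightarrow> 'w::ab_group_add \<Rightarrow> 'w" and bracket2 :: "'w \<Rightarrow> 'w \<Rightarrow> 'w"
    and S :: "'w set" and \<phi> :: "'v \<Rightarrow> 'w" +
  assumes map_bracket: "\<phi> (bracket1 x y) = bracket2 (\<phi> x) (\<phi> y)"
    and bij_onto: "bij_betw \<phi> UNIV S"

text \<open>The \<open>A\<close>-module structure on \<open>Diff1\<close> is \<open>(a D)(b) = a * D b\<close>.\<close>

locale lrj_algebra =
  alg: comm_unital_algebra smult + mdl: module scale +
  lie: lie_algebra "restrict_scalars smult scale" bracket
  for smult :: "'k::field_char_0 \<Rightarrow> 'a::comm_ring_1 \<Rightarrow> 'a"
    and scale :: "'a \<Rightarrow> 'g::ab_group_add \<Rightarrow> 'g"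
    and bracket :: "'g \<Rightarrow> 'g \<Rightarrow> 'g" +
  fixes \<rho> :: "'g \<Rightarrow> 'a \<Rightarrow> 'a"
  assumes anchor_Diff1: "\<rho> x \<in> Diff1 smult"
    and anchor_add: "\<rho> (x + y) = (\<lambda>b. \<rho> x b + \<rho> y b)"
    and anchor_scale: "\<rho> (scale a x) = (\<lambda>b. a * \<rho> x b)"
    and anchor_bracket: "\<rho> (bracket x y) = op_commutator (\<rho> x) (\<rho> y)"
    and bracket_scale:
      "bracket x (scale a y) = scale a (bracket x y) + scale (\<rho> x a - a * \<rho> x 1) y"

text \<open>A \<open>p\<close>-form is a function on argument lists, extended by 0 to lists of length other than \<open>p\<close>,
  so that equality of forms is equality of functions. The degree need not be passed to the
  operations below: they preserve this convention.\<close>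

definition alt_forms :: "('a::comm_ring_1 \<Rightarrow> 'g::ab_group_add \<Rightarrow> 'g) \<Rightarrow> nat \<Rightarrow> ('g list \<Rightarrow> 'a) set"
  where
  "alt_forms scale p = {\<beta>.
     (\<forall>xs. length xs \<noteq> p \<longrightarrow> \<beta> xs = 0) \<and>
     (\<forall>xs i. length xs = p \<longrightarrow> i < p \<longrightarrow> module_hom scale (*) (\<lambda>x. \<beta> (xs[i := x]))) \<and>
     (\<forall>xs i j. length xs = p \<longrightarrow> i < j \<longrightarrow> j < p \<longrightarrow> xs ! i = xs ! j \<longrightarrow> \<beta> xs = 0)}"

definition form0 :: "'a::zero \<Rightarrow> 'g list \<Rightarrow> 'a" where
  "form0 a = (\<lambda>xs. if xs = [] then a else 0)"

definition interior :: "'g \<Rightarrow> ('g list \<Rightarrow> 'a) \<Rightarrow> 'g list \<Rightarrow> 'a" where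
  "interior x \<beta> = (\<lambda>xs. \<beta> (x # xs))"

text \<open>\<open>nths xs (- I)\<close> is \<open>xs\<close> with the entries at the positions in \<open>I\<close> omitted.\<close>

definition lrj_d ::
  "('g \<Rightarrow> 'g \<Rightarrow> 'g) \<Rightarrow> ('g \<Rightarrow> 'a::comm_ring_1 \<Rightarrow> 'a) \<Rightarrow> ('g list \<Rightarrow> 'a) \<Rightarrow> 'g list \<Rightarrow> 'a" where
  "lrj_d bracket \<rho> \<beta> = (\<lambda>xs.
     (\<Sum>i<length xs. (-1) ^ i * \<rho> (xs ! i) (\<beta> (nths xs (- {i})))) +
     (\<Sum>j<length xs. \<Sum>i<j.
        (-1) ^ (i + j) * \<beta> (bracket (xs ! i) (xs ! j) # nths xs (- {i, j}))))"

definition lie_deriv ::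
  "('g \<Rightarrow> 'g \<Rightarrow> 'g) \<Rightarrow> ('g \<Rightarrow> 'a::comm_ring_1 \<Rightarrow> 'a) \<Rightarrow> 'g \<Rightarrow> ('g list \<Rightarrow> 'a) \<Rightarrow> 'g list \<Rightarrow> 'a" where
  "lie_deriv bracket \<rho> x \<beta> =
     (\<lambda>xs. interior x (lrj_d bracket \<rho> \<beta>) xs + lrj_d bracket \<rho> (interior x \<beta>) xs)"

text \<open>The last three axioms below say that \<open>flat \<omega>\<close> is an isomorphism of \<open>A\<close>-modules onto the dual
  module with its pointwise structure; its \<open>A\<close>-linearity already follows from \<open>omega_form\<close>.\<close>

definition flat :: "('g list \<Rightarrow> 'a) \<Rightarrow> 'g \<Rightarrow> 'g \<Rightarrow> 'a" where
  "flat \<omega> x = (\<lambda>y. interior x \<omega> [y])"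

locale symplectic_lrj_algebra = lrj_algebra smult scale bracket \<rho>
  for smult :: "'k::field_char_0 \<Rightarrow> 'a::comm_ring_1 \<Rightarrow> 'a"
    and scale :: "'a \<Rightarrow> 'g::ab_group_add \<Rightarrow> 'g"
    and bracket :: "'g \<Rightarrow> 'g \<Rightarrow> 'g"
    and \<rho> :: "'g \<Rightarrow> 'a \<Rightarrow> 'a" +
  fixes \<omega> :: "'g list \<Rightarrow> 'a"
  assumes omega_form: "\<omega> \<in> alt_forms scale 2"
    and omega_closed: "lrj_d bracket \<rho> \<omega> = (\<lambda>_. 0)"
    and flat_add: "flat \<omega> (x + y) = (\<lambda>z. flat \<omega> x z + flat \<omega> y z)"
    and flat_scale: "flat \<omega> (scale a x) = (\<lambda>z. a * flat \<omega> x z)"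
    and flat_bij: "bij_betw (flat \<omega>) UNIV {\<alpha>. module_hom scale (*) \<alpha>}"

definition symp_grad ::
  "('g \<Rightarrow> 'g \<Rightarrow> 'g) \<Rightarrow> ('g \<Rightarrow> 'a::comm_ring_1 \<Rightarrow> 'a) \<Rightarrow> ('g list \<Rightarrow> 'a) \<Rightarrow> 'a \<Rightarrow> 'g" where
  "symp_grad bracket \<rho> \<omega> a = (THE x. interior x \<omega> = lrj_d bracket \<rho> (form0 a))"

definition jacobi_bracket ::
  "('g \<Rightarrow> 'g \<Rightarrow> 'g) \<Rightarrow> ('g \<Rightarrow> 'a::comm_ring_1 \<Rightarrow> 'a) \<Rightarrow> ('g list \<Rightarrow> 'a) \<Rightarrow> 'a \<Rightarrow> 'a \<Rightarrow> 'a" where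
  "jacobi_bracket bracket \<rho> \<omega> a b =
     - \<omega> [symp_grad bracket \<rho> \<omega> a, symp_grad bracket \<rho> \<omega> b]"

text \<open>The element \<open>x + f e\<close> of the direct sum of \<open>G\<close> and \<open>A e\<close> is the pair \<open>(x, f)\<close>.\<close>

definition ext_scale ::
  "('a::comm_ring_1 \<Rightarrow> 'g \<Rightarrow> 'g) \<Rightarrow> 'a \<Rightarrow> 'g \<times> 'a \<Rightarrow> 'g \<times> 'a" where
  "ext_scale scale a = (\<lambda>(x, f). (scale a x, a * f))"

definition ext_bracket ::
  "('g \<Rightarrow> 'g \<Rightarrow> 'g) \<Rightarrow> ('g \<Rightarrow> 'a::comm_ring_1 \<Rightarrow> 'a) \<Rightarrow> ('g list \<Rightarrow> 'a) \<Rightarrow>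
   'g \<times> 'a \<Rightarrow> 'g \<times> 'a \<Rightarrow> 'g \<times> 'a" where
  "ext_bracket bracket \<rho> \<omega> = (\<lambda>(x, f) (y, g). (bracket x y, \<rho> x g - \<rho> y f + \<omega> [x, y]))"

definition ext_anchor :: "('g \<Rightarrow> 'a \<Rightarrow> 'a) \<Rightarrow> 'g \<times> 'a \<Rightarrow> 'a \<Rightarrow> 'a" where
  "ext_anchor \<rho> = (\<lambda>(x, f). \<rho> x)"

definition canonical_form :: "('g \<times> 'a::zero) list \<Rightarrow> 'a" where
  "canonical_form = (\<lambda>us. case us of [(x, f)] \<Rightarrow> f | _ \<Rightarrow> 0)"

definition strict_contact ::
  "('g \<Rightarrow> 'g \<Rightarrow> 'g) \<Rightarrow> ('g \<Rightarrow> 'a::comm_ring_1 \<Rightarrow> 'a) \<Rightarrow> ('g list \<Rightarrow> 'a) \<Rightarrow> ('g \<times> 'a) set" where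
  "strict_contact bracket \<rho> \<omega> =
     {u. lie_deriv (ext_bracket bracket \<rho> \<omega>) (ext_anchor \<rho>) u canonical_form = (\<lambda>_. 0)}"

definition contact_lift ::
  "('g \<Rightarrow> 'g \<Rightarrow> 'g) \<Rightarrow> ('g \<Rightarrow> 'a::comm_ring_1 \<Rightarrow> 'a) \<Rightarrow> ('g list \<Rightarrow> 'a) \<Rightarrow> 'a \<Rightarrow> 'g \<times> 'a" where
  "contact_lift bracket \<rho> \<omega> f = (symp_grad bracket \<rho> \<omega> f, f)"

end

theory Submission
  imports Defs
begin

text \<open>
  An element \<open>u = x + f e\<close> of the extension is a strict symmetry of \<open>\<eta>\<close> exactly when
  \<open>x\<close> is the symplectic gradient of \<open>f\<close>: in \<open>(d \<eta>)(u, v) = \<rho> x g - \<rho> y f - \<eta> [u, v]\<close>,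
  for \<open>v = y + g e\<close>, the anchor terms cancel those of the bracket, so \<open>d \<eta>\<close> is the pull-back
  of \<open>- \<omega>\<close> along the projection, while \<open>d (i\<^sub>u \<eta>) = d f\<close>. Hence \<open>L\<^sub>u \<eta> = 0\<close> reads
  \<open>\<omega>(x, y) = \<rho> y f\<close> for all \<open>y\<close>. This is \<open>strict_contact_iff\<close>, and it identifies the strict
  symmetries with the graph of the symplectic gradient, that is, with the image of the injective
  map \<open>f \<mapsto> X\<^sub>f + f e\<close>.

  That this map respects brackets comes from \<open>d \<omega> = 0\<close> evaluated at \<open>(X\<^sub>f, X\<^sub>g, z)\<close>. Rewriting
  each \<open>\<omega>(X\<^sub>a, -)\<close> as \<open>d a\<close> and using that the anchor is a morphism, all second-order
  terms cancel except those of the form \<open>\<rho> z (\<dots>)\<close>, which leaves \<open>\<omega>([X\<^sub>f, X\<^sub>g], z) = \<rho> z {f, g}\<close>;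
  thus \<open>[X\<^sub>f, X\<^sub>g]\<close> is the gradient of \<open>{f, g}\<close> (\<open>bracket_grad\<close>). The \<open>e\<close>-component follows from
  \<open>\<rho> X\<^sub>f g = - \<rho> X\<^sub>g f = {f, g}\<close>.

  The Jacobi identity is verified only once, in the extension, where it is the Jacobi identity
  of \<open>G\<close> together with \<open>d \<omega> = 0\<close> (\<open>lie_algebra_ext\<close>). The Jacobi bracket on \<open>A\<close> inherits it
  through the injective map (\<open>lie_algebra_pullback\<close>), and the strict symmetries form a
  subalgebra because they are the image of a linear bracket-preserving map
  (\<open>lie_subalgebra_range\<close>).
\<close>

section \<open>The differential in low degrees\<close>

text \<open>The differential of a \<open>p\<close>-form vanishes off lists of length \<open>Suc p\<close>, so that an
  equation between forms only has to be checked in one degree.\<close>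

lemma lrj_d_eq_0_off_degree:
  assumes "\<And>ys. length ys \<noteq> p \<Longrightarrow> \<beta> ys = 0"
    and "\<And>x. \<rho> x 0 = 0"
    and "length xs \<noteq> Suc p"
  shows "lrj_d bracket \<rho> \<beta> xs = 0"
proof -
  have len: "length (nths xs (- I)) = length xs - card I" if "I \<subseteq> {..<length xs}" for I
  proof -
    have "{i. i < length xs \<and> i \<in> - I} = {..<length xs} - I" by auto
    then show ?thesis
      using that by (simp add: length_nths card_Diff_subset finite_subset)
  qed
  have "\<beta> (nths xs (- {i})) = 0" if "i < length xs" for i
    using that assms(3) by (intro assms(1)) (auto simp: len)
  moreover have "\<beta> (bracket (xs ! i) (xs ! j) # nths xs (- {i, j})) = 0"
    if "j < length xs" "i < j" for i j
    using that assms(3) by (intro assms(1)) (auto simp: len)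
  ultimately show ?thesis
    using assms(2) by (simp add: lrj_d_def)
qed

lemma lrj_d_degree_0: "lrj_d bracket \<rho> \<beta> [x] = \<rho> x (\<beta> [])"
  by (simp add: lrj_d_def nths_Cons)

lemma lrj_d_degree_1:
  "lrj_d bracket \<rho> \<beta> [x, y] = \<rho> x (\<beta> [y]) - \<rho> y (\<beta> [x]) - \<beta> [bracket x y]"
  by (simp add: lrj_d_def nths_Cons lessThan_Suc)

lemma lrj_d_degree_2:
  "lrj_d bracket \<rho> \<beta> [x, y, z] =
     \<rho> x (\<beta> [y, z]) - \<rho> y (\<beta> [x, z]) + \<rho> z (\<beta> [x, y])
     - \<beta> [bracket x y, z] + \<beta> [bracket x z, y] - \<beta> [bracket y z, x]"
  by (simp add: lrj_d_def nths_Cons lessThan_Suc numeral_2_eq_2)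

section \<open>Transport of Lie algebra structures along linear maps\<close>

lemma lie_algebra_pullback:
  assumes lin: "Vector_Spaces.linear scale1 scale2 \<phi>"
    and inj: "inj \<phi>"
    and tgt: "lie_algebra scale2 bracket2"
    and hom: "\<And>x y. \<phi> (bracket1 x y) = bracket2 (\<phi> x) (\<phi> y)"
  shows "lie_algebra scale1 bracket1"
proof -
  interpret \<phi>: Vector_Spaces.linear scale1 scale2 \<phi> by (fact lin)
  interpret tgt: lie_algebra scale2 bracket2 by (fact tgt)
  have left: "bracket2 (u + v) w = bracket2 u w + bracket2 v w"
    "bracket2 (scale2 c u) w = scale2 c (bracket2 u w)" for u v w c
    using tgt.bracket_linear_left[of w]
    by (simp_all add: Vector_Spaces.linear_iff)
  have right: "bracket2 w (u + v) = bracket2 w u + bracket2 w v"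
    "bracket2 w (scale2 c u) = scale2 c (bracket2 w u)" for u v w c
    using tgt.bracket_linear_right[of w]
    by (simp_all add: Vector_Spaces.linear_iff)
  show ?thesis
  proof unfold_locales
    fix x y z c
    show "bracket1 (x + y) z = bracket1 x z + bracket1 y z"
      by (rule injD[OF inj]) (simp add: hom \<phi>.add left)
    show "bracket1 (scale1 c x) z = scale1 c (bracket1 x z)"
      by (rule injD[OF inj]) (simp add: hom \<phi>.scale left)
    show "bracket1 z (x + y) = bracket1 z x + bracket1 z y"
      by (rule injD[OF inj]) (simp add: hom \<phi>.add right)
    show "bracket1 z (scale1 c x) = scale1 c (bracket1 z x)"
      by (rule injD[OF inj]) (simp add: hom \<phi>.scale right)
    show "bracket1 x x = 0"
      by (rule injD[OF inj]) (simp add: hom \<phi>.zero tgt.bracket_self)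
    show "bracket1 x (bracket1 y z) + bracket1 y (bracket1 z x) + bracket1 z (bracket1 x y) = 0"
      by (rule injD[OF inj]) (simp add: hom \<phi>.add \<phi>.zero tgt.jacobi)
  qed
qed

lemma lie_subalgebra_range:
  assumes lin: "Vector_Spaces.linear scale1 scale2 \<phi>"
    and tgt: "lie_algebra scale2 bracket2"
    and hom: "\<And>x y. \<phi> (bracket1 x y) = bracket2 (\<phi> x) (\<phi> y)"
  shows "lie_subalgebra scale2 bracket2 (range \<phi>)"
proof -
  interpret \<phi>: Vector_Spaces.linear scale1 scale2 \<phi> by (fact lin)
  interpret tgt: lie_algebra scale2 bracket2 by (fact tgt)
  show ?thesis
  proof
    show "module.subspace scale2 (range \<phi>)"
      by (rule \<phi>.subspace_image[OF \<phi>.vs1.subspace_UNIV])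
    show "bracket2 u v \<in> range \<phi>" if "u \<in> range \<phi>" "v \<in> range \<phi>" for u v
      using that by (auto simp: hom[symmetric])
  qed
qed

section \<open>The extension and the symplectic gradient\<close>

context symplectic_lrj_algebra
begin

lemma anchor_linear: "Vector_Spaces.linear smult smult (\<rho> x)"
  using anchor_Diff1[of x] by (simp add: Diff1_def)

lemma anchor_arg_add: "\<rho> x (a + b) = \<rho> x a + \<rho> x b"
  using anchor_linear[of x] by (simp add: Vector_Spaces.linear_iff)

lemma anchor_arg_smult: "\<rho> x (smult c a) = smult c (\<rho> x a)"
  using anchor_linear[of x] by (simp add: Vector_Spaces.linear_iff)

lemma anchor_arg_zero: "\<rho> x 0 = 0"
  using anchor_arg_add[of x 0 0] by simp

lemma anchor_arg_minus: "\<rho> x (- a) = - \<rho> x a"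
  using anchor_arg_add[of x "- a" a] by (simp add: anchor_arg_zero eq_neg_iff_add_eq_0)

lemma anchor_arg_diff: "\<rho> x (a - b) = \<rho> x a - \<rho> x b"
  using anchor_arg_add[of x a "- b"] by (simp add: anchor_arg_minus)

lemma anchor_bracket_apply: "\<rho> (bracket x y) a = \<rho> x (\<rho> y a) - \<rho> y (\<rho> x a)"
  by (simp add: anchor_bracket op_commutator_def)

lemma smult_eq_mult: "smult c a = smult c 1 * a"
  using alg.smult_mult_left[of c 1 a] by simp

lemma omega_hom_update:
  "length xs = 2 \<Longrightarrow> i < 2 \<Longrightarrow> module_hom scale (*) (\<lambda>x. \<omega> (xs[i := x]))"
  using omega_form unfolding alt_forms_def by blast

lemma omega_hom_left: "module_hom scale (*) (\<lambda>x. \<omega> [x, y])"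
  using omega_hom_update[of "[0, y]" 0] by simp

lemma omega_hom_right: "module_hom scale (*) (\<lambda>y. \<omega> [x, y])"
  using omega_hom_update[of "[x, 0]" 1] by simp

lemma omega_bilinear:
  "\<omega> [x + y, z] = \<omega> [x, z] + \<omega> [y, z]" "\<omega> [scale a x, z] = a * \<omega> [x, z]"
  "\<omega> [z, x + y] = \<omega> [z, x] + \<omega> [z, y]" "\<omega> [z, scale a x] = a * \<omega> [z, x]"
  using module_hom.add[OF omega_hom_left] module_hom.scale[OF omega_hom_left]
    module_hom.add[OF omega_hom_right] module_hom.scale[OF omega_hom_right]
  by blast+

lemma omega_self: "\<omega> [x, x] = 0"
proof -
  have "\<forall>xs i j. length xs = 2 \<longrightarrow> i < j \<longrightarrow> j < 2 \<longrightarrow> xs ! i = xs ! j \<longrightarrow> \<omega> xs = 0"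
    using omega_form by (simp add: alt_forms_def)
  from this[rule_format, of "[x, x]" 0 1] show ?thesis by simp
qed

lemma omega_skew: "\<omega> [x, y] = - \<omega> [y, x]"
proof -
  have "\<omega> [x, y] + \<omega> [y, x] = 0"
    using omega_self[of "x + y"]
    by (simp only: omega_bilinear) (simp add: omega_self add.commute)
  then show ?thesis by (simp add: eq_neg_iff_add_eq_0)
qed

lemma omega_off_degree: "length xs \<noteq> 2 \<Longrightarrow> \<omega> xs = 0"
  using omega_form by (simp add: alt_forms_def)

lemma omega_cocycle:
  "\<rho> x (\<omega> [y, z]) - \<rho> y (\<omega> [x, z]) + \<rho> z (\<omega> [x, y])
     - \<omega> [bracket x y, z] + \<omega> [bracket x z, y] - \<omega> [bracket y z, x] = 0"
  using fun_cong[OF omega_closed, of "[x, y, z]"] by (simp add: lrj_d_degree_2)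

text \<open>The \<open>e\<close>-component of the Jacobi identity is \<open>d \<omega> = 0\<close>, up to the terms that cancel
  because the anchor is a morphism.\<close>

lemma lie_algebra_ext:
  "lie_algebra (restrict_scalars smult (ext_scale scale)) (ext_bracket bracket \<rho> \<omega>)"
proof -
  let ?s = "restrict_scalars smult (ext_scale scale)"
  let ?b = "ext_bracket bracket \<rho> \<omega>"
  have s: "?s c (x, f) = (restrict_scalars smult scale c x, smult c f)" for c x f
    by (simp add: restrict_scalars_def ext_scale_def smult_eq_mult[of c f])
  have omega_K: "\<omega> [restrict_scalars smult scale c x, y] = smult c (\<omega> [x, y])"
    "\<omega> [y, restrict_scalars smult scale c x] = smult c (\<omega> [y, x])" for c x y
    by (simp_all add: restrict_scalars_def omega_bilinear smult_eq_mult[of c "\<omega> _"])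
  have anchor_K: "\<rho> (restrict_scalars smult scale c x) a = smult c (\<rho> x a)" for c x a
    by (simp add: restrict_scalars_def anchor_scale smult_eq_mult[of c "\<rho> x a"])
  have bracket_lin:
    "bracket (x + y) z = bracket x z + bracket y z"
    "bracket z (x + y) = bracket z x + bracket z y"
    "bracket (restrict_scalars smult scale c x) z = restrict_scalars smult scale c (bracket x z)"
    "bracket z (restrict_scalars smult scale c x) = restrict_scalars smult scale c (bracket z x)"
    for x y z c
    using lie.bracket_linear_left[of z] lie.bracket_linear_right[of z]
    by (simp_all add: Vector_Spaces.linear_iff)
  interpret ext: vector_space ?s
  proof
    fix u v :: "'g \<times> 'a" and c d :: 'k
    obtain x f y g where uv: "u = (x, f)" "v = (y, g)"
      by (metis surj_pair)
    show "?s c (u + v) = ?s c u + ?s c v"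
      by (simp add: uv s lie.scale_right_distrib alg.scale_right_distrib)
    show "?s (c + d) u = ?s c u + ?s d u"
      by (simp add: uv s lie.scale_left_distrib alg.scale_left_distrib)
    show "?s c (?s d u) = ?s (c * d) u"
      by (simp add: uv s)
    show "?s 1 u = u"
      by (simp add: uv s)
  qed
  show ?thesis
  proof unfold_locales
    fix u v w :: "'g \<times> 'a" and c :: 'k
    obtain x f y g z h where uvw: "u = (x, f)" "v = (y, g)" "w = (z, h)"
      by (metis surj_pair)
    show "?b (u + v) w = ?b u w + ?b v w"
      by (simp add: uvw ext_bracket_def bracket_lin anchor_add anchor_arg_add omega_bilinear)
    show "?b (?s c u) w = ?s c (?b u w)"
      by (simp add: uvw s ext_bracket_def bracket_lin anchor_K anchor_arg_smult omega_K
          alg.scale_right_distrib alg.scale_right_diff_distrib)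
    show "?b w (u + v) = ?b w u + ?b w v"
      by (simp add: uvw ext_bracket_def bracket_lin anchor_add anchor_arg_add omega_bilinear)
    show "?b w (?s c u) = ?s c (?b w u)"
      by (simp add: uvw s ext_bracket_def bracket_lin anchor_K anchor_arg_smult omega_K
          alg.scale_right_distrib alg.scale_right_diff_distrib)
    show "?b u u = 0"
      by (simp add: uvw ext_bracket_def lie.bracket_self omega_self zero_prod_def)
    show "?b u (?b v w) + ?b v (?b w u) + ?b w (?b u v) = 0"
    proof -
      have skew: "bracket z x = - bracket x z"
        using lie.bracket_self[of "x + z"]
        by (simp only: bracket_lin) (simp add: lie.bracket_self eq_neg_iff_add_eq_0 add.commute)
      have neg: "\<omega> [y, - t] = \<omega> [t, y]" for t
        using module_hom.neg[OF omega_hom_right, of y t] omega_skew[of t y] by simp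
      have "\<rho> x (\<omega> [y, z]) + \<rho> y (\<omega> [z, x]) + \<rho> z (\<omega> [x, y])
          + \<omega> [x, bracket y z] + \<omega> [y, bracket z x] + \<omega> [z, bracket x y] = 0"
        using omega_cocycle[of x y z]
        by (simp add: skew neg omega_skew[of z x] omega_skew[of x "bracket y z"]
            omega_skew[of z "bracket x y"] anchor_arg_minus algebra_simps)
      then show ?thesis
        using lie.jacobi[of x y z]
        by (simp add: uvw ext_bracket_def anchor_bracket_apply anchor_arg_add
            anchor_arg_diff zero_prod_def algebra_simps)
    qed
  qed
qed

lemma interior_eq_d_form0_iff:
  "interior x \<omega> = lrj_d bracket \<rho> (form0 a) \<longleftrightarrow> (\<forall>y. \<omega> [x, y] = \<rho> y a)"
proof
  assume "interior x \<omega> = lrj_d bracket \<rho> (form0 a)"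
  from fun_cong[OF this] have "interior x \<omega> [y] = lrj_d bracket \<rho> (form0 a) [y]" for y .
  then show "\<forall>y. \<omega> [x, y] = \<rho> y a"
    by (simp add: interior_def lrj_d_degree_0 form0_def)
next
  assume *: "\<forall>y. \<omega> [x, y] = \<rho> y a"
  show "interior x \<omega> = lrj_d bracket \<rho> (form0 a)"
  proof
    fix xs
    show "interior x \<omega> xs = lrj_d bracket \<rho> (form0 a) xs"
    proof (cases "length xs = 1")
      case True
      then obtain y where "xs = [y]" by (auto simp: length_Suc_conv)
      with * show ?thesis by (simp add: interior_def lrj_d_degree_0 form0_def)
    next
      case False
      then have "lrj_d bracket \<rho> (form0 a) xs = 0"
        by (intro lrj_d_eq_0_off_degree[where p = 0]) (auto simp: form0_def anchor_arg_zero)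
      with False show ?thesis by (simp add: interior_def omega_off_degree)
    qed
  qed
qed

lemma omega_nondegenerate:
  assumes "\<And>z. \<omega> [x, z] = \<omega> [y, z]"
  shows "x = y"
proof -
  have "flat \<omega> x = flat \<omega> y"
    using assms by (simp add: flat_def interior_def)
  then show ?thesis
    using flat_bij by (auto simp: bij_betw_def dest: injD)
qed

text \<open>The gradient exists because \<open>y \<mapsto> \<rho> y a\<close> is \<open>A\<close>-linear, hence in the image of
  \<open>flat \<omega>\<close>.\<close>

lemma omega_eq_anchor_iff: "(\<forall>y. \<omega> [x, y] = \<rho> y a) \<longleftrightarrow> x = symp_grad bracket \<rho> \<omega> a"
proof -
  interpret target: module "(*) :: 'a \<Rightarrow> 'a \<Rightarrow> 'a"
    by unfold_locales (simp_all add: algebra_simps)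
  have "module_hom scale (*) (\<lambda>y. \<rho> y a)"
    by unfold_locales (simp_all add: anchor_add anchor_scale)
  then have "(\<lambda>y. \<rho> y a) \<in> range (flat \<omega>)"
    using flat_bij by (simp add: bij_betw_def)
  then obtain x0 where "(\<lambda>y. \<rho> y a) = flat \<omega> x0"
    by blast
  then have x0: "\<forall>y. \<omega> [x0, y] = \<rho> y a"
    by (simp add: flat_def interior_def fun_eq_iff)
  have unique: "x' = x0" if "\<forall>y. \<omega> [x', y] = \<rho> y a" for x'
    using that x0 by (intro omega_nondegenerate) simp
  have "symp_grad bracket \<rho> \<omega> a = x0"
    unfolding symp_grad_def interior_eq_d_form0_iff using x0 unique by (rule the_equality)
  with x0 unique show ?thesis by blast
qed

lemma omega_grad: "\<omega> [symp_grad bracket \<rho> \<omega> a, y] = \<rho> y a"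
  using omega_eq_anchor_iff by blast

lemma linear_contact_lift:
  "Vector_Spaces.linear smult (restrict_scalars smult (ext_scale scale))
     (contact_lift bracket \<rho> \<omega>)"
proof -
  interpret ext: lie_algebra "restrict_scalars smult (ext_scale scale)" "ext_bracket bracket \<rho> \<omega>"
    by (fact lie_algebra_ext)
  show ?thesis
  proof unfold_locales
    fix a b :: 'a and c :: 'k
    have "symp_grad bracket \<rho> \<omega> (a + b) = symp_grad bracket \<rho> \<omega> a + symp_grad bracket \<rho> \<omega> b"
      by (rule omega_nondegenerate) (simp add: omega_bilinear omega_grad anchor_arg_add)
    then show "contact_lift bracket \<rho> \<omega> (a + b)
        = contact_lift bracket \<rho> \<omega> a + contact_lift bracket \<rho> \<omega> b"
      by (simp add: contact_lift_def)
    have "symp_grad bracket \<rho> \<omega> (smult c a) = scale (smult c 1) (symp_grad bracket \<rho> \<omega> a)"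
      by (rule omega_nondegenerate)
        (simp add: omega_bilinear omega_grad anchor_arg_smult smult_eq_mult[symmetric])
    then show "contact_lift bracket \<rho> \<omega> (smult c a)
        = restrict_scalars smult (ext_scale scale) c (contact_lift bracket \<rho> \<omega> a)"
      by (simp add: contact_lift_def restrict_scalars_def ext_scale_def smult_eq_mult[symmetric])
  qed
qed

section \<open>Bracket preservation and strict symmetries\<close>

lemma jacobi_bracket_skew: "jacobi_bracket bracket \<rho> \<omega> g f = - jacobi_bracket bracket \<rho> \<omega> f g"
  unfolding jacobi_bracket_def by (subst omega_skew) (rule refl)

lemma anchor_grad: "\<rho> (symp_grad bracket \<rho> \<omega> f) g = jacobi_bracket bracket \<rho> \<omega> f g"
  unfolding jacobi_bracket_def omega_grad[of g, symmetric] by (rule omega_skew)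

text \<open>In \<open>d \<omega> = 0\<close> at \<open>(X\<^sub>f, X\<^sub>g, z)\<close>, the anchor turns \<open>\<omega>([X\<^sub>f, z], X\<^sub>g)\<close> into
  \<open>- \<rho> X\<^sub>f (\<rho> z g) + \<rho> z {f, g}\<close>, and the other mixed term likewise. The terms \<open>\<rho> z {f, g}\<close> then
  occur three times, once with a minus sign (from \<open>\<rho> z (\<omega>(X\<^sub>f, X\<^sub>g))\<close>) and twice with a plus.
  Left over are one of them and \<open>- \<omega>([X\<^sub>f, X\<^sub>g], z)\<close>.\<close>

lemma bracket_grad:
  "bracket (symp_grad bracket \<rho> \<omega> f) (symp_grad bracket \<rho> \<omega> g)
     = symp_grad bracket \<rho> \<omega> (jacobi_bracket bracket \<rho> \<omega> f g)"
proof -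
  let ?X = "symp_grad bracket \<rho> \<omega>"
  let ?h = "jacobi_bracket bracket \<rho> \<omega> f g"
  have "\<omega> [bracket (?X f) (?X g), z] = \<rho> z ?h" for z
  proof -
    have swap: "\<omega> [t, ?X a] = - \<rho> t a" for t a
      using omega_skew[of t "?X a"] by (simp add: omega_grad)
    have omega_XX: "\<omega> [?X f, ?X g] = - ?h"
      by (simp add: jacobi_bracket_def)
    have "\<omega> [bracket (?X f) (?X g), z]
        = \<rho> (?X f) (\<rho> z g) - \<rho> (?X g) (\<rho> z f) - \<rho> z ?h
          - \<rho> (bracket (?X f) z) g + \<rho> (bracket (?X g) z) f"
      using omega_cocycle[of "?X f" "?X g" z]
      by (simp only: omega_grad[of _ z] omega_XX swap[of "bracket y z" for y] anchor_arg_minus) (simp add: algebra_simps)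
    then show ?thesis
      by (simp add: anchor_bracket_apply anchor_grad jacobi_bracket_skew[of g f] anchor_arg_minus)
  qed
  then show ?thesis using omega_eq_anchor_iff by blast
qed

lemma ext_bracket_contact_lift:
  "ext_bracket bracket \<rho> \<omega> (contact_lift bracket \<rho> \<omega> f) (contact_lift bracket \<rho> \<omega> g)
     = contact_lift bracket \<rho> \<omega> (jacobi_bracket bracket \<rho> \<omega> f g)"
  by (simp add: contact_lift_def ext_bracket_def bracket_grad anchor_grad
      jacobi_bracket_skew[of g f])
    (simp add: jacobi_bracket_def)

text \<open>The coefficient \<open>g\<close> drops out: \<open>\<rho> x g\<close> occurs in \<open>d \<eta>\<close> and, with the opposite sign,
  in the \<open>e\<close>-component of the bracket. For \<open>- \<rho> y f\<close> the same happens, and the remaining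
  \<open>\<rho> y f\<close> is \<open>d (i\<^sub>u \<eta>)\<close>.\<close>

lemma lie_deriv_canonical_form:
  "lie_deriv (ext_bracket bracket \<rho> \<omega>) (ext_anchor \<rho>) (x, f) canonical_form [(y, g)]
     = \<rho> y f - \<omega> [x, y]"
  by (simp add: lie_deriv_def interior_def lrj_d_degree_0 lrj_d_degree_1 canonical_form_def
      ext_anchor_def ext_bracket_def)

lemma lie_deriv_canonical_form_off_degree:
  assumes "length us \<noteq> 1"
  shows "lie_deriv (ext_bracket bracket \<rho> \<omega>) (ext_anchor \<rho>) u canonical_form us = 0"
proof -
  have eta: "canonical_form vs = (0 :: 'a)" if "length vs \<noteq> 1" for vs :: "('g \<times> 'a) list"
    using that by (auto simp: canonical_form_def split: list.split)
  have anchor: "ext_anchor \<rho> v 0 = 0" for v :: "'g \<times> 'a"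
    by (simp add: ext_anchor_def anchor_arg_zero split: prod.split)
  have "lrj_d (ext_bracket bracket \<rho> \<omega>) (ext_anchor \<rho>) canonical_form (u # us) = 0"
    using assms by (intro lrj_d_eq_0_off_degree[where p = 1]) (auto simp: eta anchor)
  moreover have
    "lrj_d (ext_bracket bracket \<rho> \<omega>) (ext_anchor \<rho>) (interior u canonical_form) us = 0"
    using assms by (intro lrj_d_eq_0_off_degree[where p = 0]) (auto simp: interior_def eta anchor)
  ultimately show ?thesis
    by (simp add: lie_deriv_def interior_def)
qed

lemma strict_contact_iff:
  "(x, f) \<in> strict_contact bracket \<rho> \<omega> \<longleftrightarrow> x = symp_grad bracket \<rho> \<omega> f"
proof -
  let ?L = "lie_deriv (ext_bracket bracket \<rho> \<omega>) (ext_anchor \<rho>) (x, f) canonical_form"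
  have "?L = (\<lambda>_. 0) \<longleftrightarrow> (\<forall>y. \<omega> [x, y] = \<rho> y f)"
  proof
    assume "?L = (\<lambda>_. 0)"
    from fun_cong[OF this] have "?L [(y, 0)] = 0" for y .
    then show "\<forall>y. \<omega> [x, y] = \<rho> y f"
      by (simp add: lie_deriv_canonical_form)
  next
    assume *: "\<forall>y. \<omega> [x, y] = \<rho> y f"
    show "?L = (\<lambda>_. 0)"
    proof
      fix us
      show "?L us = 0"
      proof (cases "length us = 1")
        case True
        then obtain y g where "us = [(y, g)]" by (auto simp: length_Suc_conv)
        with * show ?thesis by (simp add: lie_deriv_canonical_form)
      qed (rule lie_deriv_canonical_form_off_degree)
    qed
  qed
  then show ?thesis
    by (simp add: strict_contact_def omega_eq_anchor_iff)
qed

lemma range_contact_lift: "range (contact_lift bracket \<rho> \<omega>) = strict_contact bracket \<rho> \<omega>"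
  by (auto simp: contact_lift_def strict_contact_iff)

end

theorem theorem6p4:
  fixes smult :: "'k::field_char_0 \<Rightarrow> 'a::comm_ring_1 \<Rightarrow> 'a"
    and scale :: "'a \<Rightarrow> 'g::ab_group_add \<Rightarrow> 'g"
    and bracket :: "'g \<Rightarrow> 'g \<Rightarrow> 'g"
    and \<rho> :: "'g \<Rightarrow> 'a \<Rightarrow> 'a"
    and \<omega> :: "'g list \<Rightarrow> 'a"
  assumes "symplectic_lrj_algebra smult scale bracket \<rho> \<omega>"
  shows "Vector_Spaces.linear smult (restrict_scalars smult (ext_scale scale))
           (contact_lift bracket \<rho> \<omega>) \<and>
         inj (contact_lift bracket \<rho> \<omega>) \<and>
         (\<forall>f g. ext_bracket bracket \<rho> \<omega>
                  (contact_lift bracket \<rho> \<omega> f) (contact_lift bracket \<rho> \<omega> g) =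
                contact_lift bracket \<rho> \<omega> (jacobi_bracket bracket \<rho> \<omega> f g)) \<and>
         lie_algebra_iso_onto
           smult (jacobi_bracket bracket \<rho> \<omega>)
           (restrict_scalars smult (ext_scale scale)) (ext_bracket bracket \<rho> \<omega>)
           (strict_contact bracket \<rho> \<omega>)
           (contact_lift bracket \<rho> \<omega>)"
proof -
  interpret symplectic_lrj_algebra smult scale bracket \<rho> \<omega> by (fact assms)
  note lin = linear_contact_lift
  have inj: "inj (contact_lift bracket \<rho> \<omega>)"
    by (auto simp: inj_def contact_lift_def)
  have "lie_algebra smult (jacobi_bracket bracket \<rho> \<omega>)"
    by (rule lie_algebra_pullback[OF lin inj lie_algebra_ext])
      (rule ext_bracket_contact_lift[symmetric])
  moreover have "lie_subalgebra (restrict_scalars smult (ext_scale scale))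
      (ext_bracket bracket \<rho> \<omega>) (strict_contact bracket \<rho> \<omega>)"
    unfolding range_contact_lift[symmetric]
    by (rule lie_subalgebra_range[OF lin lie_algebra_ext])
      (rule ext_bracket_contact_lift[symmetric])
  moreover have "bij_betw (contact_lift bracket \<rho> \<omega>) UNIV (strict_contact bracket \<rho> \<omega>)"
    using inj by (simp add: bij_betw_def range_contact_lift)
  ultimately have "lie_algebra_iso_onto
      smult (jacobi_bracket bracket \<rho> \<omega>)
      (restrict_scalars smult (ext_scale scale)) (ext_bracket bracket \<rho> \<omega>)
      (strict_contact bracket \<rho> \<omega>) (contact_lift bracket \<rho> \<omega>)"
    using lin
    by (simp add: lie_algebra_iso_onto_def lie_algebra_iso_onto_axioms_def
        ext_bracket_contact_lift)
  with lin inj show ?thesis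
    by (simp add: ext_bracket_contact_lift)
qed

end
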